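(* Let $r\ge 3$ be an integer. For all sufficiently large $s$ (depending on $r$), $n_{r/2}(s)$ attains the Griesmer upper bound, i.e. $n_{r/2}(s)$ is equal to the largest integer $n$ such that $g\left(r,2(n-s)\right)\le 3n$.
   Context: $\operatorname{PG}(r-1,2)$ denotes the lattice of subspaces of $\mathbb{F}_2^r$; dimensions are vector space dimensions, and points, lines, hyperplanes are the subspaces of dimension $1$, $2$, $r-1$, respectively. An $(n,r,s)$ system is a multiset of $n$ lines in $\operatorname{PG}(r-1,2)$ such that each hyperplane contains at most $s$ of these lines (counted with multiplicity) and some hyperplane contains exactly $s$ of them; it is called spanning iff $s<n$. For $k$ with $2k$ a positive integer, $n_k(s)$ denotes the maximum $n$ such that a spanning $(n,2k,s)$ system exists; this is the same as the maximal length $n$ of an additive quaternary code (a subset of $\mathbb{F}_4^n$ closed under componentwise addition) with $4^k$ codewords and minimum Hamming distance $n-s$. For positive integers $k,d$ put $g(k,d):=\sum_{i=0}^{k-1}\left\lceil \frac{d}{2^i}\right\rceil$. *)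

theory Defs
  imports "HOL-Analysis.Cartesian_Space" "HOL-Library.Z2" "HOL-Library.Multiset"
begin

text \<open>The ambient space of \<open>PG(r-1,2)\<close> is \<^typ>\<open>bit^'n\<close> with \<open>r = CARD('n)\<close>.\<close>

definition pg_line :: "(bit^'n::finite) set \<Rightarrow> bool" where
  "pg_line L \<longleftrightarrow> vec.subspace L \<and> vec.dim L = 2"

definition pg_hyperplane :: "(bit^'n::finite) set \<Rightarrow> bool" where
  "pg_hyperplane H \<longleftrightarrow> vec.subspace H \<and> vec.dim H = CARD('n) - 1"

definition lines_in :: "(bit^'n::finite) set multiset \<Rightarrow> (bit^'n) set \<Rightarrow> nat" where
  "lines_in M H = size {# L \<in># M. L \<subseteq> H #}"

definition line_system :: "nat \<Rightarrow> nat \<Rightarrow> (bit^'n::finite) set multiset \<Rightarrow> bool" where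
  "line_system n s M \<longleftrightarrow>
     size M = n \<and>
     (\<forall>L \<in># M. pg_line L) \<and>
     (\<forall>H. pg_hyperplane H \<longrightarrow> lines_in M H \<le> s) \<and>
     (\<exists>H. pg_hyperplane H \<and> lines_in M H = s)"

definition spanning_system :: "nat \<Rightarrow> nat \<Rightarrow> (bit^'n::finite) set multiset \<Rightarrow> bool" where
  "spanning_system n s M \<longleftrightarrow> line_system n s M \<and> s < n"

definition spanning_lengths :: "'n::finite itself \<Rightarrow> nat \<Rightarrow> nat set" where
  "spanning_lengths _ s = {n. \<exists>M :: (bit^'n) set multiset. spanning_system n s M}"

definition is_maximum :: "nat set \<Rightarrow> nat \<Rightarrow> bool" where
  "is_maximum A m \<longleftrightarrow> m \<in> A \<and> (\<forall>n \<in> A. n \<le> m)"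

text \<open>
  \<open>n_half TYPE('n) s\<close> is \<open>n\<^sub>k(s)\<close> for \<open>k = CARD('n) / 2\<close>. It is meaningful only if
  \<^const>\<open>spanning_lengths\<close> has a maximum, i.e. is finite and nonempty.
\<close>

definition n_half :: "'n::finite itself \<Rightarrow> nat \<Rightarrow> nat" where
  "n_half t s = Max (spanning_lengths t s)"

definition griesmer :: "nat \<Rightarrow> nat \<Rightarrow> int" where
  "griesmer k d = (\<Sum>i<k. \<lceil>real d / 2 ^ i\<rceil>)"

text \<open>
  The condition \<open>s < n\<close> keeps the argument \<open>d = 2(n - s)\<close> of the Griesmer sum positive, and
  makes the truncated subtraction exact. For \<open>n \<le> s\<close> the inequality would hold trivially, so the
  condition does not change the maximum once some \<open>n > s\<close> qualifies.
\<close>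

definition griesmer_lengths :: "nat \<Rightarrow> nat \<Rightarrow> nat set" where
  "griesmer_lengths r s = {n. s < n \<and> griesmer r (2 * (n - s)) \<le> 3 * int n}"

end

theory Submission
  imports Defs
begin

text \<open>
  The points of the lines of a system form a binary code with even weights, so every length obeys
  the Griesmer bound. Conversely put \<open>t = n - s\<close>. A point multiset attaining the bound for minimum
  weight \<open>2t\<close> is an integer combination of a flag of subspaces; the coefficient of the \<open>i\<close>-th
  member, of projective dimension \<open>i\<close>, is \<open>u\<^sub>i - 2u\<^sub>i\<^sub>+\<^sub>1\<close> with \<open>u\<^sub>i = \<lceil>2t / 2^i\<rceil>\<close>, which
  telescopes both in the cardinality and in the weights. If \<open>p\<close> is the smallest member, the
  pencils of lines through \<open>p\<close> show that this multiset is congruent to a multiple of \<open>p\<close> modulo the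
  lattice generated by the lines, and \<open>6p\<close> lies in that lattice; since \<open>3\<close> divides the number of
  points, the whole multiset does. Finally, for large \<open>s\<close> it contains many copies of the whole
  space, and since the rest takes only finitely many values, an integer combination of lines can
  be turned into a nonnegative one by adding copies of a multiset of lines that covers all points
  equally often.
\<close>

subsection \<open>Vector spaces over the field with two elements\<close>

lemma bit_vec_add_self [simp]: "(x :: bit^'n) + x = 0"
  by (simp add: vec_eq_iff)

lemma bit_vec_add_add [simp]: "(x :: bit^'n) + (x + y) = y"
  by (simp add: add.assoc [symmetric])

lemma bit_vec_uminus [simp]: "- (x :: bit^'n) = x"
  by (metis bit_vec_add_self minus_unique)

lemma bit_vec_minus [simp]: "(x :: bit^'n) - y = x + y"
  by (metis add_uminus_conv_diff bit_vec_uminus)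

lemma bit_vec_add_eq_0_iff [simp]: "(x :: bit^'n) + y = 0 \<longleftrightarrow> x = y"
  by (metis bit_vec_minus right_minus_eq)

lemma bit_vec_add_eq_iff: "(x :: bit^'n) + y = z \<longleftrightarrow> x = y + z"
  by (metis add.commute bit_vec_add_add)

lemma card_bit_vec: "CARD(bit^'n::finite) = 2 ^ CARD('n)"
proof -
  have "(UNIV :: bit set) = {0, 1}" using bit_not_one_iff by auto
  then have "CARD(bit) = 2" by (metis card_2_iff zero_neq_one)
  then show ?thesis by simp
qed

lemma finite_bit_vec [simp]: "finite (S :: (bit^'n::finite) set)"
  by (metis card_bit_vec card_gt_0_iff finite_subset subset_UNIV zero_less_numeral zero_less_power)

lemma subspace_bit_vecI:
  assumes "0 \<in> S" "\<And>x y. x \<in> S \<Longrightarrow> y \<in> S \<Longrightarrow> x + y \<in> S"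
  shows "vec.subspace (S :: (bit^'n) set)"
  unfolding vec.subspace_def
proof (intro conjI ballI allI)
  show "c *s x \<in> S" if "x \<in> S" for c x
    using that assms(1) by (cases c) (simp_all)
qed (use assms in auto)

lemma span_insert_bit_vec: "x \<in> vec.span (insert a S) \<longleftrightarrow> x \<in> vec.span S \<or> x + a \<in> vec.span (S :: (bit^'n) set)"
proof -
  have "(\<exists>k::bit. P k) \<longleftrightarrow> P 0 \<or> P 1" for P
    by (metis bit_not_one_iff)
  then show ?thesis
    by (simp add: vec.span_breakdown_eq)
qed

abbreviation line_thru :: "bit^'n \<Rightarrow> bit^'n \<Rightarrow> (bit^'n) set" where
  "line_thru u v \<equiv> {0, u, v, u + v}"

lemma pg_line_iff: "pg_line L \<longleftrightarrow> (\<exists>u v. u \<noteq> 0 \<and> v \<noteq> 0 \<and> u \<noteq> v \<and> L = line_thru u v)"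
proof
  assume L: "pg_line L"
  then obtain B where B: "vec.independent B" "vec.span B = L" "card B = 2"
    by (metis pg_line_def vec.basis_exists vec.span_subspace)
  then obtain u v where uv: "B = {u, v}" "u \<noteq> v" by (meson card_2_iff)
  have "x \<in> L \<longleftrightarrow> x \<in> line_thru u v" for x
    unfolding B(2)[symmetric] uv(1)
    by (auto simp: span_insert_bit_vec bit_vec_add_eq_iff[of x u v])
  moreover have "u \<noteq> 0" "v \<noteq> 0" using B(1) uv vec.dependent_zero by blast+
  ultimately show "\<exists>u v. u \<noteq> 0 \<and> v \<noteq> 0 \<and> u \<noteq> v \<and> L = line_thru u v"
    using uv by blast
next
  assume "\<exists>u v. u \<noteq> 0 \<and> v \<noteq> 0 \<and> u \<noteq> v \<and> L = line_thru u v"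
  then obtain u v where uv: "u \<noteq> 0" "v \<noteq> 0" "u \<noteq> v" "L = line_thru u v" by blast
  have "x \<in> vec.span {u, v} \<longleftrightarrow> x \<in> L" for x
    using uv by (auto simp: span_insert_bit_vec bit_vec_add_eq_iff[of x u v])
  then have eq: "vec.span {u, v} = L" by blast
  have "vec.independent {u, v}"
    using uv by (simp add: vec.independent_insert span_insert_bit_vec)
  then have "vec.dim {u, v} = 2" using uv by (simp add: vec.dim_eq_card_independent)
  then show "pg_line L"
    unfolding pg_line_def eq[symmetric] by simp
qed

section \<open>Linear forms and hyperplanes\<close>

definition dotb :: "bit^'n::finite \<Rightarrow> bit^'n \<Rightarrow> bit" where
  "dotb c x = (\<Sum>i\<in>UNIV. c $ i * x $ i)"

lemma dotb_add_left: "dotb (c + c') x = dotb c x + dotb c' x"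
  unfolding dotb_def vector_add_component distrib_right sum.distrib ..

lemma dotb_add_right: "dotb c (x + y) = dotb c x + dotb c y"
  unfolding dotb_def vector_add_component distrib_left sum.distrib ..

lemma dotb_0 [simp]: "dotb 0 x = 0" "dotb c 0 = 0"
  by (simp_all add: dotb_def)

lemma dotb_nonzero:
  assumes "c \<noteq> 0"
  obtains x where "dotb c x = 1"
proof -
  obtain i where i: "c $ i \<noteq> 0" using assms by (auto simp: vec_eq_iff)
  have "dotb c (axis i 1) = (\<Sum>j\<in>UNIV. if i = j then c $ i else 0)"
    unfolding dotb_def axis_def by (rule sum.cong) auto
  with i that show thesis by simp
qed

lemma pg_hyperplane_dotb:
  assumes "c \<noteq> 0"
  shows "pg_hyperplane {x. dotb c x = 0}" (is "pg_hyperplane ?H")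
proof -
  have sub: "vec.subspace ?H"
    by (rule subspace_bit_vecI) (auto simp: dotb_add_right)
  obtain a where a: "dotb c a = 1" using assms dotb_nonzero by blast
  have "x \<in> vec.span (insert a ?H)" for x
    using a sub by (cases "dotb c x") (auto simp: span_insert_bit_vec dotb_add_right vec.span_eq_iff[THEN iffD2])
  then have "vec.dim (insert a ?H) = CARD('a)"
    by (metis UNIV_eq_I vec.dim_span vec_dim_card)
  moreover have "a \<notin> vec.span ?H" using a sub by (simp add: vec.span_eq_iff[THEN iffD2])
  ultimately have "vec.dim ?H = CARD('a) - 1"
    by (simp add: vec.dim_insert split: if_splits)
  with sub show ?thesis by (simp add: pg_hyperplane_def)
qed

lemma pg_hyperplane_subspace: "pg_hyperplane H \<Longrightarrow> vec.subspace H"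
  by (simp add: pg_hyperplane_def)

text \<open>A hyperplane has index two as a subgroup, so two vectors outside it lie in the same
  coset.\<close>

lemma pg_hyperplane_add_iff:
  fixes x y :: "bit^'n::finite"
  assumes H: "pg_hyperplane H"
  shows "x + y \<in> H \<longleftrightarrow> (x \<in> H \<longleftrightarrow> y \<in> H)"
proof -
  note sub = pg_hyperplane_subspace[OF H]
  have *: "u + v \<in> H" if "u \<in> H" "v \<in> H" for u v
    using sub that by (rule vec.subspace_add)
  have **: "x + y \<in> H" if "x \<notin> H" "y \<notin> H"
  proof -
    have span: "vec.span H = H" using sub by (simp add: vec.span_eq_iff)
    have "x \<notin> vec.span H" unfolding span by (rule that)
    then have "vec.dim (insert x H) = CARD('n)"
      using H by (simp add: vec.dim_insert pg_hyperplane_def del: vec.span_eq_iff)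
    then have "vec.span (insert x H) = UNIV"
      by (metis vec.dim_eq_full vec.dim_UNIV vec_dim_card vec.dimension_def)
    then have "y \<in> vec.span (insert x H)" by simp
    then show ?thesis unfolding span_insert_bit_vec span using that by (simp add: add.commute)
  qed
  have "y \<in> H" if "x + y \<in> H" "x \<in> H"
    using *[OF that(2,1)] by simp
  moreover have "x \<in> H" if "x + y \<in> H" "y \<in> H"
    using *[OF that(2,1)] by (metis add.commute bit_vec_add_add)
  ultimately show ?thesis
    using *[of x y] ** by blast
qed

subsection \<open>The Griesmer bound\<close>

lemma griesmer_mono: "d \<le> d' \<Longrightarrow> griesmer k d \<le> griesmer k d'"
  unfolding griesmer_def by (intro sum_mono ceiling_mono divide_right_mono) auto

lemma griesmer_0 [simp]: "griesmer 0 d = 0"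
  by (simp add: griesmer_def)

text \<open>The first summand is \<open>w\<close> itself; the later ones are those of
  \<open>w / 2\<close> shifted by one index, and \<open>w / 2\<close> is at most
  \<open>v\<close>.\<close>

lemma griesmer_Suc_le:
  assumes "w \<le> 2 * v"
  shows "griesmer (Suc k) w \<le> int w + griesmer k v"
proof -
  have "real w / 2 ^ Suc i \<le> real v / 2 ^ i" for i
    using assms by (simp add: field_simps)
  then have "(\<Sum>i<k. \<lceil>real w / 2 ^ Suc i\<rceil>) \<le> (\<Sum>i<k. \<lceil>real v / 2 ^ i\<rceil>)"
    by (intro sum_mono ceiling_mono)
  then show ?thesis
    unfolding griesmer_def sum.lessThan_Suc_shift by simp
qed

text \<open>
  The vectors of \<open>span B\<close> are the codewords of a code with positions \<open>X\<close>, each \<open>x\<close> repeated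
  \<open>f x\<close> times. The induction passes to the residual code with respect to a codeword \<open>c0\<close> of
  minimum weight: the positions where \<open>c0\<close> vanishes, and a complement of \<open>c0\<close> in \<open>span B\<close>.
\<close>

lemma griesmer_bound:
  fixes B :: "(bit^'n::finite) set" and f :: "bit^'n \<Rightarrow> nat"
  assumes "vec.independent B" and "finite X"
    and "\<And>c. c \<in> vec.span B \<Longrightarrow> c \<noteq> 0 \<Longrightarrow> d \<le> (\<Sum>x | x \<in> X \<and> dotb c x = 1. f x)"
  shows "griesmer (card B) d \<le> int (\<Sum>x\<in>X. f x)"
  using assms
proof (induction "card B" arbitrary: B X d)
  case 0
  then show ?case unfolding 0(1)[symmetric] griesmer_0 by (simp only: of_nat_0_le_iff)
next
  case (Suc k)
  have filter_sum: "(\<Sum>x | x \<in> X \<and> P x. f x) = (\<Sum>x\<in>X. if P x then f x else 0)" for P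
    using Suc.prems(2) by (rule sum.inter_filter)
  define wt where "wt c = (\<Sum>x | x \<in> X \<and> dotb c x = 1. f x)" for c
  have "finite (vec.span B - {0})" by simp
  moreover have "vec.span B - {0} \<noteq> {}"
  proof -
    obtain b where "b \<in> B" using Suc.hyps(2) by fastforce
    then have "b \<in> vec.span B" "b \<noteq> 0"
      using vec.span_base vec.dependent_zero Suc.prems(1) by blast+
    then show ?thesis by blast
  qed
  ultimately obtain c0 where c0: "c0 \<in> vec.span B - {0}"
    and min: "\<And>c. c \<in> vec.span B - {0} \<Longrightarrow> wt c0 \<le> wt c"
    by (metis arg_min_if_finite(1) arg_min_least)
  have "vec.independent {c0}" using c0 by (simp add: vec.independent_insert)
  \<comment> \<open>Exchange to a basis of the same span that contains \<open>c0\<close>; the rest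
    of it spans a complement of \<open>c0\<close>.\<close>
  then obtain C where C: "{c0} \<subseteq> C" "C \<subseteq> vec.span B" "vec.independent C" "vec.span B \<subseteq> vec.span C"
    using c0 by (metis Diff_iff empty_subsetI insert_subset vec.maximal_independent_subset_extend)
  define B' where "B' = C - {c0}"
  have C_eq: "C = insert c0 B'" "c0 \<notin> B'" using C by (auto simp: B'_def)
  have span: "vec.span C = vec.span B"
    using C by (metis subset_antisym vec.span_mono vec.span_span)
  have "card C = card B"
    using C(3) Suc.prems(1) span by (metis vec.dim_span_eq_card_independent)
  moreover have "finite C" by simp
  ultimately have card: "k = card B'" using Suc.hyps(2) C_eq by simp
  have ind: "vec.independent B'" "c0 \<notin> vec.span B'"
    using C(3) C_eq by (auto simp: vec.independent_insert)
  define X' where "X' = {x \<in> X. dotb c0 x = 0}"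
  define v where "v = (wt c0 + 1) div 2"
  have "v \<le> (\<Sum>x | x \<in> X' \<and> dotb c x = 1. f x)" if c: "c \<in> vec.span B'" "c \<noteq> 0" for c
  proof -
    have sub: "vec.span B' \<subseteq> vec.span B" using C_eq span by (metis subset_insertI vec.span_mono)
    have 1: "c \<in> vec.span B - {0}" using c sub by blast
    have "c + c0 \<in> vec.span B" using 1 c0 by (simp add: vec.span_add)
    moreover have "c + c0 \<noteq> 0" using c ind by auto
    ultimately have 2: "c + c0 \<in> vec.span B - {0}" by blast
    \<comment> \<open>A position where \<open>c0\<close> vanishes counts for both of
      \<open>c\<close> and \<open>c + c0\<close> or for neither; any other position counts for
      exactly one of them.\<close>
    have "wt c + wt (c + c0) = 2 * (\<Sum>x | x \<in> X' \<and> dotb c x = 1. f x) + wt c0"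
      unfolding wt_def X'_def mem_Collect_eq conj_assoc filter_sum sum_distrib_left sum.distrib[symmetric]
    proof (rule sum.cong)
      show "(if dotb c x = 1 then f x else 0) + (if dotb (c + c0) x = 1 then f x else 0) =
          2 * (if dotb c0 x = 0 \<and> dotb c x = 1 then f x else 0) + (if dotb c0 x = 1 then f x else 0)" for x
        by (cases "dotb c x"; cases "dotb c0 x") (simp_all add: dotb_add_left)
    qed simp
    with min[OF 1] min[OF 2] show ?thesis unfolding v_def by linarith
  qed
  with Suc.hyps(1)[OF card ind(1), of X' v] Suc.prems(2)
  have IH: "griesmer k v \<le> int (\<Sum>x\<in>X'. f x)"
    unfolding card[symmetric] by (simp add: X'_def)
  have "d \<le> wt c0" using Suc.prems(3)[of c0] c0 by (simp add: wt_def)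
  then have "griesmer (card B) d \<le> griesmer (Suc k) (wt c0)"
    unfolding Suc.hyps(2)[symmetric] by (rule griesmer_mono)
  also have "\<dots> \<le> int (wt c0) + griesmer k v"
    by (rule griesmer_Suc_le) (simp add: v_def)
  also have "\<dots> \<le> int (wt c0 + (\<Sum>x\<in>X'. f x))" using IH by simp
  also have "wt c0 + (\<Sum>x\<in>X'. f x) = (\<Sum>x\<in>X. f x)"
    unfolding wt_def X'_def filter_sum sum.distrib[symmetric] by (rule sum.cong) auto
  finally show ?case .
qed

text \<open>Lines are subspaces and contain 0, which is not a point; only the values at nonzero
  vectors are point multiplicities.\<close>

definition mult_at :: "(bit^'n) set multiset \<Rightarrow> bit^'n \<Rightarrow> nat" where
  "mult_at M x = (\<Sum>L\<in>#M. of_bool (x \<in> L))"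

lemma mult_at_simps [simp]:
  "mult_at {#} x = 0" "mult_at (add_mset L M) x = of_bool (x \<in> L) + mult_at M x"
  "mult_at (A + B) x = mult_at A x + mult_at B x"
  by (simp_all add: mult_at_def)

lemma sum_mult_at_points:
  fixes M :: "(bit^'n::finite) set multiset"
  assumes "\<forall>L\<in>#M. pg_line L"
  shows "(\<Sum>x\<in>-{0}. mult_at M x) = 3 * size M"
  using assms
proof (induction M)
  case (add L M)
  then obtain u v where uv: "u \<noteq> 0" "v \<noteq> 0" "u \<noteq> v" "L = line_thru u v"
    by (auto simp: pg_line_iff)
  have "(\<Sum>x\<in>-{0}. of_bool (x \<in> L)) = card {u, v, u + v}"
    using uv by (subst sum_of_bool_eq) (simp, simp only: of_nat_id, rule arg_cong[of _ _ card], auto)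
  also have "\<dots> = 3" using uv by simp
  finally show ?case using add by (simp add: sum.distrib)
qed simp

text \<open>A line not contained in \<open>H\<close> meets it in one point and has two points off
  \<open>H\<close>; a line inside \<open>H\<close> has none.\<close>

lemma sum_mult_at_hyperplane:
  fixes M :: "(bit^'n::finite) set multiset"
  assumes H: "pg_hyperplane H" and "\<forall>L\<in>#M. pg_line L"
  shows "(\<Sum>x\<in>-H. mult_at M x) + 2 * lines_in M H = 2 * size M"
  using assms(2)
proof (induction M)
  case (add L M)
  then obtain u v where uv: "u \<noteq> 0" "v \<noteq> 0" "u \<noteq> v" "L = line_thru u v"
    by (auto simp: pg_line_iff)
  have 0: "0 \<in> H" using H by (simp add: pg_hyperplane_def vec.subspace_0)
  note add_iff = pg_hyperplane_add_iff[OF H]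
  have "(\<Sum>x\<in>-H. of_bool (x \<in> L)) = card (L - H)"
    by (subst sum_of_bool_eq) (auto intro!: arg_cong[of _ _ card])
  moreover have "card (L - H) = (if L \<subseteq> H then 0 else 2)"
  proof (cases "u \<in> H")
    case True
    show ?thesis
    proof (cases "v \<in> H")
      case False
      have "L - H = {v, u + v}" using uv 0 add_iff[of u v] True False by auto
      then show ?thesis using uv False by auto
    qed (use True uv 0 add_iff[of u v] in auto)
  next
    case uF: False
    show ?thesis
    proof (cases "v \<in> H")
      case True
      have "L - H = {u, u + v}" using uv 0 add_iff[of u v] True uF by auto
      then show ?thesis using uv uF by auto
    next
      case False
      have "L - H = {u, v}" using uv 0 add_iff[of u v] False uF by auto
      then show ?thesis using uv uF by auto
    qed
  qed
  ultimately show ?case using add by (simp add: sum.distrib lines_in_def)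
qed (simp add: lines_in_def)

text \<open>The point multiplicities define a code. The weight of \<open>c\<close> counts the points
  off the hyperplane given by \<open>c\<close>, which is twice the number of lines not contained in
  it.\<close>

lemma griesmer_lines:
  fixes M :: "(bit^'n::finite) set multiset"
  assumes "\<forall>L\<in>#M. pg_line L" and "\<And>H. pg_hyperplane H \<Longrightarrow> lines_in M H \<le> s"
  shows "griesmer CARD('n) (2 * (size M - s)) \<le> 3 * int (size M)"
proof -
  obtain B :: "(bit^'n) set" where B: "vec.independent B" "card B = vec.dim (UNIV :: (bit^'n) set)"
    by (metis vec.basis_exists)
  have "griesmer (card B) (2 * (size M - s)) \<le> int (\<Sum>x\<in>-{0}. mult_at M x)"
  proof (rule griesmer_bound[OF B(1)])
    fix c :: "bit^'n" assume "c \<noteq> 0"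
    define H where "H = {x. dotb c x = 0}"
    have H: "pg_hyperplane H" unfolding H_def using \<open>c \<noteq> 0\<close> by (rule pg_hyperplane_dotb)
    have "{x. x \<in> -{0} \<and> dotb c x = 1} = -H" by (auto simp: H_def)
    with sum_mult_at_hyperplane[OF H assms(1)] assms(2)[OF H]
    show "2 * (size M - s) \<le> (\<Sum>x | x \<in> -{0} \<and> dotb c x = 1. mult_at M x)" by simp
  qed simp
  then show ?thesis
    unfolding sum_mult_at_points[OF assms(1)] B(2) vec_dim_card by simp
qed

subsection \<open>The lattice generated by the lines\<close>

text \<open>Integer combinations of lines are encoded as differences of two multisets. Equality is
  demanded only at nonzero vectors, since 0 is no point.\<close>

definition line_lattice :: "(bit^'n::finite \<Rightarrow> int) set" where
  "line_lattice = {f. \<exists>A B. (\<forall>L\<in>#A + B. pg_line L) \<and> (\<forall>x. x \<noteq> 0 \<longrightarrow> f x = int (mult_at A x) - int (mult_at B x))}"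

lemma line_latticeI:
  assumes "\<forall>L\<in>#A. pg_line L" "\<forall>L\<in>#B. pg_line L"
    "\<And>x. x \<noteq> 0 \<Longrightarrow> f x = int (mult_at A x) - int (mult_at B x)"
  shows "f \<in> line_lattice"
  unfolding line_lattice_def
  by (intro CollectI exI[of _ A] exI[of _ B]) (use assms in auto)

lemma line_latticeE:
  assumes "f \<in> line_lattice"
  obtains A B where "\<forall>L\<in>#A. pg_line L" "\<forall>L\<in>#B. pg_line L"
    "\<And>x. x \<noteq> 0 \<Longrightarrow> f x = int (mult_at A x) - int (mult_at B x)"
  using assms unfolding line_lattice_def by auto

lemma line_lattice_cong:
  assumes "f \<in> line_lattice" "\<And>x. x \<noteq> 0 \<Longrightarrow> f x = g x"
  shows "g \<in> line_lattice"
  using assms by (simp add: line_lattice_def)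

lemma line_lattice_0: "(\<lambda>_. 0) \<in> line_lattice"
  by (rule line_latticeI[of "{#}" "{#}"]) auto

lemma line_lattice_line: "pg_line L \<Longrightarrow> (\<lambda>x. of_bool (x \<in> L)) \<in> line_lattice"
  by (rule line_latticeI[of "{#L#}" "{#}"]) auto

lemma line_lattice_add:
  assumes "f \<in> line_lattice" "g \<in> line_lattice"
  shows "(\<lambda>x. f x + g x) \<in> line_lattice"
proof -
  obtain A B where AB: "\<forall>L\<in>#A. pg_line L" "\<forall>L\<in>#B. pg_line L"
    "\<And>x. x \<noteq> 0 \<Longrightarrow> f x = int (mult_at A x) - int (mult_at B x)"
    using assms(1) line_latticeE by blast
  obtain A' B' where AB': "\<forall>L\<in>#A'. pg_line L" "\<forall>L\<in>#B'. pg_line L"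
    "\<And>x. x \<noteq> 0 \<Longrightarrow> g x = int (mult_at A' x) - int (mult_at B' x)"
    using assms(2) line_latticeE by blast
  show ?thesis
    by (rule line_latticeI[of "A + A'" "B + B'"]) (use AB AB' in auto)
qed

lemma line_lattice_uminus:
  assumes "f \<in> line_lattice"
  shows "(\<lambda>x. - f x) \<in> line_lattice"
proof -
  obtain A B where AB: "\<forall>L\<in>#A. pg_line L" "\<forall>L\<in>#B. pg_line L"
    "\<And>x. x \<noteq> 0 \<Longrightarrow> f x = int (mult_at A x) - int (mult_at B x)"
    using assms line_latticeE by blast
  show ?thesis by (rule line_latticeI[of B A]) (use AB in auto)
qed

lemma line_lattice_diff:
  assumes "f \<in> line_lattice" "g \<in> line_lattice"
  shows "(\<lambda>x. f x - g x) \<in> line_lattice"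
  using line_lattice_add[OF assms(1) line_lattice_uminus[OF assms(2)]] by simp

lemma line_lattice_scale:
  assumes "f \<in> line_lattice"
  shows "(\<lambda>x. c * f x) \<in> line_lattice"
proof -
  have nat: "(\<lambda>x. int k * f x) \<in> line_lattice" for k
  proof (induction k)
    case (Suc k)
    show ?case using line_lattice_add[OF Suc assms] by (simp add: algebra_simps)
  qed (simp add: line_lattice_0)
  show ?thesis
  proof (cases c rule: int_cases2)
    case (nonneg k)
    then show ?thesis using nat by simp
  next
    case (nonpos k)
    then show ?thesis using line_lattice_uminus[OF nat[of k]] by simp
  qed
qed

lemma line_lattice_sum:
  assumes "finite I" "\<And>i. i \<in> I \<Longrightarrow> g i \<in> line_lattice"
  shows "(\<lambda>x. \<Sum>i\<in>I. g i x) \<in> line_lattice"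
  using assms by (induction I) (simp_all add: line_lattice_0 line_lattice_add)

text \<open>In the plane spanned by \<open>p\<close>, \<open>q\<close>, \<open>w\<close>, two lines
  through \<open>p\<close> and two lines through \<open>q\<close> cover the same four points off the
  line through \<open>p\<close> and \<open>q\<close>, once each. Their difference leaves only
  \<open>p\<close> and \<open>q\<close>, twice each.\<close>

lemma line_lattice_two_diff:
  fixes p q w :: "bit^'n::finite"
  assumes "p \<noteq> 0" "q \<noteq> 0" "p \<noteq> q" "w \<notin> {0, p, q, p + q}"
  shows "(\<lambda>x. 2 * of_bool (x = p) - 2 * of_bool (x = q)) \<in> line_lattice"
proof -
  have neq: "w \<noteq> 0" "w \<noteq> p" "w \<noteq> q" "w \<noteq> p + q" using assms by auto
  have ne: "q + w \<noteq> 0" "p + w \<noteq> 0" "q + w \<noteq> p" "p + w \<noteq> q"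
    using neq by (auto simp: bit_vec_add_eq_iff[of q w] bit_vec_add_eq_iff[of p w] add.commute)
  have eqs: "p + (q + w) = p + q + w" "q + (p + w) = p + q + w"
    by (simp_all add: add_ac)
  have "(\<lambda>x. of_bool (x \<in> line_thru p w) + of_bool (x \<in> line_thru p (q + w)) -
      (of_bool (x \<in> line_thru q w) + of_bool (x \<in> line_thru q (p + w)))) \<in> line_lattice"
    using assms neq ne
    by (intro line_lattice_diff line_lattice_add line_lattice_line pg_line_iff[THEN iffD2])
      (rule exI conjI refl | blast | metis)+
  then show ?thesis
  proof (rule line_lattice_cong)
    have ne': "p \<noteq> q + w" "p \<noteq> p + q + w" "q \<noteq> p + w" "q \<noteq> p + q + w" "p + w \<noteq> q + w"
       "p + w \<noteq> p + q + w" "q + w \<noteq> p + q + w" "w \<noteq> p + w" "w \<noteq> q + w" "w \<noteq> p + q + w"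
      using assms ne neq by (auto simp: add.assoc)
    fix x :: "bit^'n" assume "x \<noteq> 0"
    then show "of_bool (x \<in> line_thru p w) + of_bool (x \<in> line_thru p (q + w)) -
      (of_bool (x \<in> line_thru q w) + of_bool (x \<in> line_thru q (p + w))) =
      (2 * of_bool (x = p) - 2 * of_bool (x = q) :: int)"
      unfolding eqs using ne' assms(3) neq
      by (cases "x = p"; cases "x = q"; cases "x = w"; cases "x = p + w"; cases "x = q + w"; cases "x = p + q + w")
        (simp_all del: add.assoc)
  qed
qed

text \<open>Twice the line through \<open>p\<close> and \<open>q\<close> becomes six copies of
  \<open>p\<close> once the two copies of each other point are moved to \<open>p\<close>.\<close>

lemma line_lattice_six:
  fixes p :: "bit^'n::finite"
  assumes "3 \<le> CARD('n)" "p \<noteq> 0"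
  shows "(\<lambda>x. 6 * of_bool (x = p)) \<in> line_lattice"
proof -
  \<comment> \<open>There are at least eight vectors, so a line together with 0 does not exhaust the
    space.\<close>
  have big: "\<exists>w. w \<notin> S" if "card S < 8" for S :: "(bit^'n) set"
  proof (rule ccontr)
    assume "\<nexists>w. w \<notin> S"
    then have "S = UNIV" by blast
    moreover have "(2::nat) ^ 3 \<le> 2 ^ CARD('n)" using assms(1) by (rule power_increasing) simp
    ultimately show False using that by (simp del: CARD_vec add: card_bit_vec)
  qed
  have le: "card {a, b, c, d} < 8" "card {a, b} < 8" for a b c d :: "bit^'n"
    using card_length[of "[a, b, c, d]"] card_length[of "[a, b]"] by simp_all
  obtain q where q: "q \<notin> {0, p}" using big[OF le(2)] by blast
  obtain w where w: "w \<notin> {0, p, q, p + q}" using big[OF le(1)] by blast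
  have 1: "(\<lambda>x. 2 * of_bool (x = p) - 2 * of_bool (x = q)) \<in> line_lattice"
    using assms q w by (intro line_lattice_two_diff[of _ _ w]) auto
  have 2: "(\<lambda>x. 2 * of_bool (x = p) - 2 * of_bool (x = p + q)) \<in> line_lattice"
    using assms q w by (intro line_lattice_two_diff[of _ _ w]) auto
  have 3: "(\<lambda>x. of_bool (x \<in> line_thru p q)) \<in> line_lattice"
    using assms q by (intro line_lattice_line) (auto simp: pg_line_iff)
  show ?thesis
  proof (rule line_lattice_cong[OF line_lattice_add[OF line_lattice_scale[OF 3, of 2] line_lattice_add[OF 1 2]]])
    fix x :: "bit^'n" assume "x \<noteq> 0"
    then show "2 * of_bool (x \<in> line_thru p q) + (2 * of_bool (x = p) - 2 * of_bool (x = q) +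
      (2 * of_bool (x = p) - 2 * of_bool (x = p + q))) = (6 * of_bool (x = p) :: int)"
      using assms q by (cases "x = p"; cases "x = q"; cases "x = p + q") auto
  qed
qed

text \<open>
  The lines through \<open>p\<close> in \<open>V\<close>, one for each nonzero point of the complement \<open>U\<close>, cover \<open>p\<close>
  \<open>card U - 1\<close> times and every other point of \<open>V\<close> once.
\<close>

lemma line_lattice_pencil:
  fixes U V :: "(bit^'n::finite) set"
  assumes "p \<noteq> 0" "0 \<in> U" "p \<notin> U" "V = U \<union> (+) p ` U" "U \<inter> (+) p ` U = {}"
  shows "(\<lambda>x. of_bool (x \<in> V) + (int (card U) - 2) * of_bool (x = p)) \<in> line_lattice"
proof -
  have "(\<lambda>x. \<Sum>v\<in>U - {0}. of_bool (x \<in> line_thru p v)) \<in> line_lattice"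
    using assms by (intro line_lattice_sum line_lattice_line) (auto simp: pg_line_iff)
  then show ?thesis
  proof (rule line_lattice_cong)
    fix x :: "bit^'n" assume "x \<noteq> 0"
    have card: "int (card U - Suc 0) = int (card U) - 1"
      using \<open>0 \<in> U\<close> card_gt_0_iff[of U] by auto
    have "(\<Sum>v\<in>U - {0}. of_bool (x \<in> line_thru p v)) =
      (\<Sum>v\<in>U - {0}. of_bool (x = p) + of_bool (v = x) + of_bool (v = p + x) :: int)"
    proof (rule sum.cong)
      fix v assume "v \<in> U - {0}"
      then show "of_bool (x \<in> line_thru p v) = (of_bool (x = p) + of_bool (v = x) + of_bool (v = p + x) :: int)"
        using assms \<open>x \<noteq> 0\<close> by (auto simp: bit_vec_add_eq_iff[of p x])
    qed simp
    \<comment> \<open>The condition \<open>x \<noteq> p\<close> remains because for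
      \<open>x = p\<close> the summand would need \<open>v = 0\<close>, which the sum omits.\<close>
    also have "\<dots> = (int (card U) - 1) * of_bool (x = p) + of_bool (x \<in> U) + of_bool (p + x \<in> U \<and> x \<noteq> p)"
      using assms \<open>x \<noteq> 0\<close> card by (simp add: sum.distrib of_bool_def) auto
    also have "p + x \<in> U \<longleftrightarrow> x \<in> (+) p ` U"
      by (metis bit_vec_add_add image_iff)
    finally show "(\<Sum>v\<in>U - {0}. of_bool (x \<in> line_thru p v)) =
        of_bool (x \<in> V) + (int (card U) - 2) * of_bool (x = p)"
      using assms by auto
  qed
qed

subsection \<open>Uniform covers\<close>

lemma mult_at_sum: "mult_at (\<Sum>i\<in>I. M i) x = (\<Sum>i\<in>I. mult_at (M i) x)"
  by (induction I rule: infinite_finite_induct) simp_all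

lemma mult_at_repeat [simp]: "mult_at (repeat_mset m P) x = m * mult_at P x"
  by (induction m) simp_all

lemma uniform_line_cover:
  assumes "3 \<le> CARD('n::finite)"
  obtains P :: "(bit^'n) set multiset" and \<mu> :: nat where "\<mu> > 0"
    "\<And>L. L \<in># P \<longleftrightarrow> pg_line L" "\<And>x. x \<noteq> 0 \<Longrightarrow> mult_at P x = \<mu>"
proof -
  define N :: "(bit^'n) set" where "N = -{0}"
  \<comment> \<open>Every ordered pair of distinct points contributes its line. A point then occurs
    as \<open>u\<close>, as \<open>v\<close> and as \<open>u + v\<close>, each time for
    \<open>card N - 1\<close> pairs.\<close>
  define P where "P = (\<Sum>u\<in>N. \<Sum>v\<in>N - {u}. {#line_thru u v#})"
  define \<mu> where "\<mu> = 3 * (card N - 1)"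
  have "card N = 2 ^ CARD('n) - 1" by (simp add: N_def Compl_eq_Diff_UNIV card_Diff_singleton card_bit_vec del: CARD_vec)
  moreover have "(2::nat) ^ 3 \<le> 2 ^ CARD('n)" using assms by (rule power_increasing) simp
  ultimately have "\<mu> > 0" by (simp add: \<mu>_def)
  moreover have "L \<in># P \<longleftrightarrow> pg_line L" for L
    by (auto simp: P_def N_def pg_line_iff set_mset_sum)
  moreover have "mult_at P x = \<mu>" if "x \<noteq> 0" for x
  proof -
    have "mult_at P x = (\<Sum>u\<in>N. \<Sum>v\<in>N - {u}. of_bool (u = x) + of_bool (v = x) + of_bool (v = u + x))"
      unfolding P_def mult_at_sum
      using that by (intro sum.cong refl) (auto simp: N_def bit_vec_add_eq_iff)
    also have "\<dots> = (\<Sum>u\<in>N. (card N - 1) * of_bool (u = x) + of_bool (u \<noteq> x) + of_bool (u \<noteq> x))"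
    proof (rule sum.cong[OF refl])
      fix u assume "u \<in> N"
      have "(\<Sum>v\<in>N - {u}. of_bool (v = x)) = (of_bool (u \<noteq> x) :: nat)"
        using that by (auto simp: of_bool_def N_def)
      moreover have "(\<Sum>v\<in>N - {u}. of_bool (v = u + x)) = (of_bool (u \<noteq> x) :: nat)"
        using that \<open>u \<in> N\<close> by (auto simp: of_bool_def N_def)
      ultimately show "(\<Sum>v\<in>N - {u}. of_bool (u = x) + of_bool (v = x) + of_bool (v = u + x)) =
          (card N - 1) * of_bool (u = x) + of_bool (u \<noteq> x) + (of_bool (u \<noteq> x) :: nat)"
        using \<open>u \<in> N\<close> by (simp add: sum.distrib card_Diff_singleton)
    qed
    also have "\<dots> = \<mu>"
    proof -
      have "x \<in> N" using that by (simp add: N_def)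
      then have "(\<Sum>u\<in>N. of_bool (u \<noteq> x)) = card N - 1"
        by (subst sum_of_bool_eq) (simp, simp only: of_nat_id, subst card_Diff_singleton[symmetric], auto intro: arg_cong[of _ _ card])
      moreover have "(\<Sum>u\<in>N. (card N - 1) * of_bool (u = x)) = card N - 1"
        using \<open>x \<in> N\<close> by (simp add: of_bool_def if_distrib cong: if_cong)
      ultimately show ?thesis by (simp add: sum.distrib \<mu>_def)
    qed
    finally show ?thesis .
  qed
  ultimately show thesis using that by blast
qed

text \<open>Write \<open>f\<close> as \<open>A\<close> minus \<open>B\<close>. Every line occurs in
  \<open>P\<close>, so \<open>size B\<close> copies of \<open>P\<close> contain \<open>B\<close>,
  and the negative part can be taken out of them.\<close>

lemma line_lattice_shift_nonneg:
  fixes P :: "(bit^'n::finite) set multiset" and f :: "bit^'n \<Rightarrow> int"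
  assumes P: "\<And>L. L \<in># P \<longleftrightarrow> pg_line L" "\<And>x. x \<noteq> 0 \<Longrightarrow> mult_at P x = \<mu>"
    and f: "f \<in> line_lattice"
  shows "\<exists>m0. \<forall>m\<ge>m0. \<exists>M. (\<forall>L\<in>#M. pg_line L) \<and> (\<forall>x. x \<noteq> 0 \<longrightarrow> int (mult_at M x) = f x + int (m * \<mu>))"
proof -
  obtain A B where AB: "\<forall>L\<in>#A. pg_line L" "\<forall>L\<in>#B. pg_line L"
    "\<And>x. x \<noteq> 0 \<Longrightarrow> f x = int (mult_at A x) - int (mult_at B x)"
    using f line_latticeE by blast
  have "\<exists>M. (\<forall>L\<in>#M. pg_line L) \<and> (\<forall>x. x \<noteq> 0 \<longrightarrow> int (mult_at M x) = f x + int (m * \<mu>))"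
    if m: "m \<ge> size B" for m
  proof -
    have "B \<subseteq># repeat_mset m P"
    proof (rule mset_subset_eqI)
      fix L
      show "count B L \<le> count (repeat_mset m P) L"
      proof (cases "L \<in># B")
        case True
        then have "1 \<le> count P L" using AB(2) P(1) by simp
        moreover have "count B L \<le> m" using m count_le_size[of B L] by linarith
        ultimately have "count B L * 1 \<le> m * count P L" by (intro mult_le_mono)
        then show ?thesis by simp
      qed (simp add: not_in_iff)
    qed
    then obtain C where C: "repeat_mset m P = B + C" by (metis mset_subset_eq_exists_conv)
    have "L \<in># P" if "L \<in># C" for L
    proof -
      have "L \<in># repeat_mset m P" using that C by simp
      then show ?thesis by (metis count_greater_zero_iff count_repeat_mset nat_0_less_mult_iff)
    qed
    then have "\<forall>L\<in>#A + C. pg_line L" using AB(1) P(1) by auto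
    moreover have "int (mult_at (A + C) x) = f x + int (m * \<mu>)" if "x \<noteq> 0" for x
      using arg_cong[OF C, of "\<lambda>M. mult_at M x"] AB(3)[OF that] P(2)[OF that] by simp
    ultimately show ?thesis by blast
  qed
  then show ?thesis by blast
qed

text \<open>Only finitely many integer functions on the finite space are bounded by
  \<open>K\<close>, so the largest of their thresholds serves all of them.\<close>

lemma line_lattice_bounded_shift_nonneg:
  fixes P :: "(bit^'n::finite) set multiset"
  assumes P: "\<And>L. L \<in># P \<longleftrightarrow> pg_line L" "\<And>x. x \<noteq> 0 \<Longrightarrow> mult_at P x = \<mu>"
  shows "\<exists>m0. \<forall>f\<in>line_lattice :: (bit^'n \<Rightarrow> int) set. (\<forall>x. \<bar>f x\<bar> \<le> K) \<longrightarrow>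
    (\<forall>m\<ge>m0. \<exists>M. (\<forall>L\<in>#M. pg_line L) \<and> (\<forall>x. x \<noteq> 0 \<longrightarrow> int (mult_at M x) = f x + int (m * \<mu>)))"
    (is "\<exists>m0. \<forall>f\<in>_. _ \<longrightarrow> (\<forall>m\<ge>m0. ?Q f m)")
proof -
  define F where "F = {f \<in> line_lattice :: (bit^'n \<Rightarrow> int) set. \<forall>x. \<bar>f x\<bar> \<le> K}"
  have "F \<subseteq> PiE UNIV (\<lambda>_. {-K..K})"
    unfolding F_def by (auto simp: abs_le_iff) (metis minus_le_iff)
  then have "finite F" by (rule finite_subset) (simp add: finite_PiE)
  have "\<forall>f\<in>F. \<exists>m0. \<forall>m\<ge>m0. ?Q f m"
    unfolding F_def using line_lattice_shift_nonneg[OF P] by blast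
  then obtain m0 where m0: "\<forall>f\<in>F. \<forall>m\<ge>m0 f. ?Q f m" by metis
  have "\<forall>m\<ge>Max (m0 ` F). ?Q f m" if "f \<in> F" for f
    using m0 that \<open>finite F\<close> by (metis Max_ge finite_imageI imageI le_trans)
  then show ?thesis unfolding F_def by blast
qed

subsection \<open>Flags\<close>

definition support_in :: "'n set \<Rightarrow> (bit^'n::finite) set" where
  "support_in S = {x. \<forall>i. x $ i \<noteq> 0 \<longrightarrow> i \<in> S}"

lemma support_in_add: "x \<in> support_in S \<Longrightarrow> y \<in> support_in S \<Longrightarrow> x + y \<in> support_in S"
  by (auto simp: support_in_def)

lemma support_in_insert:
  assumes "i \<notin> S"
  shows "support_in (insert i S) = support_in S \<union> (+) (axis i 1) ` support_in S"
    and "support_in S \<inter> (+) (axis i 1) ` support_in S = {}"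
proof -
  have "x \<in> support_in S \<union> (+) (axis i 1) ` support_in S" if x: "x \<in> support_in (insert i S)" for x
  proof (cases "x $ i")
    case zero
    then show ?thesis using x by (auto simp: support_in_def)
  next
    case one
    then have "axis i 1 + x \<in> support_in S"
      using x by (auto simp: support_in_def axis_def split: if_splits)
    then show ?thesis by (metis UnI2 bit_vec_add_add imageI)
  qed
  then show "support_in (insert i S) = support_in S \<union> (+) (axis i 1) ` support_in S"
    by (auto simp: support_in_def axis_def split: if_splits)
  show "support_in S \<inter> (+) (axis i 1) ` support_in S = {}"
  proof -
    have "axis i 1 + y \<notin> support_in S" if "y \<in> support_in S" for y
    proof -
      have "y $ i = 0" using that assms by (auto simp: support_in_def)
      then have "(axis i 1 + y) $ i \<noteq> 0" by (simp add: axis_def)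
      then show ?thesis using assms unfolding support_in_def by blast
    qed
    then show ?thesis by blast
  qed
qed

lemma card_support_in: "card (support_in S) = 2 ^ card S"
proof -
  have "finite S" by simp
  then show ?thesis
  proof (induction S)
    case empty
    have "support_in ({} :: 'a set) = {0}" by (auto simp: support_in_def vec_eq_iff)
    then show ?case by simp
  next
    case (insert i S)
    then show ?case
      by (simp add: support_in_insert card_Un_disjoint card_image)
  qed
qed

text \<open>The index of a member of the flag is its projective dimension.\<close>

locale pg_flag =
  fixes p :: "bit^'n::finite" and V :: "nat \<Rightarrow> (bit^'n) set"
  assumes p_nonzero: "p \<noteq> 0"
    and V_top: "V (CARD('n) - 1) = UNIV"
    and V_card: "\<And>k. k < CARD('n) \<Longrightarrow> card (V k) = 2 ^ Suc k"
    and V_0: "\<And>k. 0 \<in> V k"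
    and V_add: "\<And>k x y. x \<in> V k \<Longrightarrow> y \<in> V k \<Longrightarrow> x + y \<in> V k"
    and V_mono: "\<And>j k. j \<le> k \<Longrightarrow> V j \<subseteq> V k"
    and V_lattice: "\<And>k. k < CARD('n) \<Longrightarrow>
      (\<lambda>x. of_bool (x \<in> V k) + (2 ^ k - 2) * of_bool (x = p)) \<in> line_lattice"

text \<open>The coordinates are numbered by \<open>h\<close>. The \<open>k\<close>-th member
  consists of the vectors supported on numbers up to \<open>k\<close>, and \<open>p\<close> is the
  unit vector numbered 0. Dropping its coordinate gives the complement \<open>U k\<close> that the
  pencil needs.\<close>

lemma pg_flag_exists:
  obtains p :: "bit^'n::finite" and V where "pg_flag p V"
proof -
  obtain h :: "'n \<Rightarrow> nat" where h: "bij_betw h UNIV {..<CARD('n)}"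
    using finite_same_card_bij[of "UNIV :: 'n set" "{..<CARD('n)}"] by auto
  define T where "T k = {i. h i \<le> k}" for k
  have card_T: "card (T k) = Suc k" if "k < CARD('n)" for k
  proof -
    have "h ` T k = {..k}"
      using h that unfolding T_def bij_betw_def by (auto simp: image_iff)
    moreover have "inj_on h (T k)" using h by (meson bij_betw_def inj_on_subset subset_UNIV)
    ultimately show ?thesis by (metis card_atMost card_image)
  qed
  obtain i0 where i0: "h i0 = 0"
    using h by (metis bij_betw_iff_bijections lessThan_iff zero_less_card_finite)
  define p :: "bit^'n" where "p = axis i0 1"
  define V where "V k = support_in (T k)" for k
  define U where "U k = support_in (T k - {i0})" for k
  have pi0: "p $ i0 = 1" by (simp add: p_def axis_def)
  have T_eq: "T k = insert i0 (T k - {i0})" for k using i0 by (auto simp: T_def)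
  have "pg_flag p V"
  proof
    show "p \<noteq> 0" using pi0 by auto
    have "T (CARD('n) - 1) = UNIV"
      using h unfolding T_def bij_betw_def by (auto simp: set_eq_iff) (metis Suc_pred le_simps(2) lessThan_iff rangeI zero_less_card_finite)
    then show "V (CARD('n) - 1) = UNIV" by (simp add: V_def support_in_def)
    show "card (V k) = 2 ^ Suc k" if "k < CARD('n)" for k
      using card_T[OF that] by (simp add: V_def card_support_in)
    show "0 \<in> V k" for k by (simp add: V_def support_in_def)
    show "x + y \<in> V k" if "x \<in> V k" "y \<in> V k" for k x y
      using that by (simp add: V_def support_in_add)
    show "V j \<subseteq> V k" if "j \<le> k" for j k
      using that by (fastforce simp: V_def support_in_def T_def)
    show "(\<lambda>x. of_bool (x \<in> V k) + (2 ^ k - 2) * of_bool (x = p)) \<in> line_lattice" if "k < CARD('n)" for k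
    proof -
      have "card (U k) = 2 ^ k"
        using card_T[OF that] i0 by (simp add: U_def card_support_in card_Diff_singleton T_def)
      moreover have "V k = U k \<union> (+) p ` U k" "U k \<inter> (+) p ` U k = {}"
        using support_in_insert[of i0 "T k - {i0}"] T_eq[of k] by (auto simp: U_def V_def p_def)
      moreover have "0 \<in> U k" "p \<notin> U k"
        using pi0 by (auto simp: U_def support_in_def)
      ultimately show ?thesis
        using line_lattice_pencil[of p "U k" "V k"] \<open>p \<noteq> 0\<close> by simp
    qed
  qed
  then show thesis by (rule that)
qed

text \<open>Translation by a vector of \<open>S\<close> outside \<open>H\<close> exchanges
  \<open>S \<inter> H\<close> and \<open>S - H\<close>, so exactly half of \<open>S\<close> lies off
  \<open>H\<close>.\<close>

lemma card_diff_hyperplane: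
  fixes S :: "(bit^'n::finite) set"
  assumes H: "pg_hyperplane H" and add: "\<And>x y. x \<in> S \<Longrightarrow> y \<in> S \<Longrightarrow> x + y \<in> S" and "\<not> S \<subseteq> H"
  shows "card S = 2 * card (S - H)"
proof -
  obtain a where a: "a \<in> S" "a \<notin> H" using assms by blast
  note iff = pg_hyperplane_add_iff[OF H]
  have "S - H = (+) a ` (S \<inter> H)"
  proof
    show "S - H \<subseteq> (+) a ` (S \<inter> H)"
    proof
      fix x assume "x \<in> S - H"
      then have "a + x \<in> S \<inter> H" using a add iff by auto
      then show "x \<in> (+) a ` (S \<inter> H)" by (metis bit_vec_add_add imageI)
    qed
  qed (use a add iff in auto)
  then have "card (S - H) = card (S \<inter> H)" by (simp add: card_image)
  then show ?thesis using card_Int_Diff[of S H] by simp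
qed

subsection \<open>Griesmer point multisets\<close>

lemma sum_telescope_weighted:
  fixes u :: "nat \<Rightarrow> int"
  assumes "m \<le> r"
  shows "(\<Sum>i\<in>{m..<r}. (u i - 2 * u (Suc i)) * 2 ^ i) = 2 ^ m * u m - 2 ^ r * u r"
  using assms by (induction r rule: dec_induct) (simp_all add: algebra_simps)

lemma ceiling_half_bounds: "\<bar>\<lceil>y\<rceil> - 2 * \<lceil>y / 2\<rceil>\<bar> \<le> 1" for y :: real
proof -
  have "\<lceil>y\<rceil> \<le> 2 * \<lceil>y / 2\<rceil>" by linarith
  moreover have "2 * \<lceil>y / 2\<rceil> \<le> \<lceil>y\<rceil> + 1" by linarith
  ultimately show ?thesis by linarith
qed

text \<open>The cut-off to 0 from index \<open>r\<close> on makes the top flag coefficient the last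
  Griesmer term itself and lets the telescoping sums end without remainder.\<close>

definition griesmer_term :: "nat \<Rightarrow> nat \<Rightarrow> nat \<Rightarrow> int" where
  "griesmer_term r d i = (if i < r then \<lceil>real d / 2 ^ i\<rceil> else 0)"

definition flag_coeff :: "nat \<Rightarrow> nat \<Rightarrow> nat \<Rightarrow> int" where
  "flag_coeff r d i = griesmer_term r d i - 2 * griesmer_term r d (Suc i)"

lemma flag_coeff_bound: "Suc i < r \<Longrightarrow> \<bar>flag_coeff r d i\<bar> \<le> 1"
  using ceiling_half_bounds[of "real d / 2 ^ i"] by (simp add: flag_coeff_def griesmer_term_def mult.commute)

text \<open>The factor \<open>2 ^ i\<close> is the number of points of the \<open>i\<close>-th flag
  member off a hyperplane not containing it, so this is the weight when \<open>m\<close> is the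
  first such member.\<close>

lemma sum_flag_coeff_weighted:
  assumes "m < r"
  shows "(\<Sum>i\<in>{m..<r}. flag_coeff r d i * 2 ^ i) = 2 ^ m * \<lceil>real d / 2 ^ m\<rceil>"
  unfolding flag_coeff_def using assms
  by (subst sum_telescope_weighted) (auto simp: griesmer_term_def)

text \<open>Shifting the index drops only the first term, which is \<open>d\<close>, so the sum is
  \<open>g - 2 * (g - d)\<close> for the Griesmer sum \<open>g\<close>.\<close>

lemma sum_flag_coeff:
  assumes "0 < r"
  shows "(\<Sum>i<r. flag_coeff r d i) = 2 * int d - griesmer r d"
proof -
  have g: "griesmer r d = (\<Sum>i<r. griesmer_term r d i)"
    by (simp add: griesmer_def griesmer_term_def)
  have "(\<Sum>i<Suc r. griesmer_term r d i) = int d + (\<Sum>i<r. griesmer_term r d (Suc i))"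
    using assms by (subst sum.lessThan_Suc_shift) (simp add: griesmer_term_def)
  then have "griesmer r d = int d + (\<Sum>i<r. griesmer_term r d (Suc i))"
    unfolding g by (simp add: griesmer_term_def)
  then show ?thesis
    unfolding flag_coeff_def sum_subtractf sum_distrib_left[symmetric] g[symmetric] by simp
qed

text \<open>Passing to the next length raises \<open>d\<close> by 2. At the maximal length this
  bounds the slack in the Griesmer inequality independently of \<open>s\<close>.\<close>

lemma griesmer_step: "griesmer r (d + 2) \<le> griesmer r d + 2 * int r"
proof -
  have "\<lceil>real (d + 2) / 2 ^ i\<rceil> \<le> \<lceil>real d / 2 ^ i\<rceil> + 2" for i
  proof -
    have "(2::real) / 2 ^ i \<le> 2" by (simp add: field_simps)
    then have "real (d + 2) / 2 ^ i \<le> real d / 2 ^ i + 2" by (simp add: add_divide_distrib)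
    then show ?thesis by linarith
  qed
  then have "griesmer r (d + 2) \<le> (\<Sum>i<r. \<lceil>real d / 2 ^ i\<rceil> + 2)"
    unfolding griesmer_def by (intro sum_mono)
  then show ?thesis by (simp add: griesmer_def sum.distrib)
qed

lemma sum_of_bool_card: "finite A \<Longrightarrow> (\<Sum>x\<in>A. of_bool (x \<in> B)) = int (card (A \<inter> B))"
  by (subst sum_of_bool_eq) (auto intro: arg_cong[of _ _ card])

text \<open>
  The point multiset of a Griesmer code as a combination of the flag \<open>V\<close>, with \<open>e\<close> extra points
  supplied by the summand \<open>L - 2p\<close>: it has one point and nonnegative even weights, because \<open>p\<close>
  lies on the line \<open>L\<close>.
\<close>

definition griesmer_points ::
    "(nat \<Rightarrow> (bit^'n::finite) set) \<Rightarrow> bit^'n \<Rightarrow> (bit^'n) set \<Rightarrow> nat \<Rightarrow> int \<Rightarrow> bit^'n \<Rightarrow> int" where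
  "griesmer_points V p L d e x =
     (\<Sum>i<CARD('n). flag_coeff CARD('n) d i * of_bool (x \<in> V i)) +
     e * (of_bool (x \<in> L) - 2 * of_bool (x = p))"

locale pg_flag_line = pg_flag p V for p :: "bit^'n::finite" and V +
  fixes L :: "(bit^'n) set"
  assumes dim: "3 \<le> CARD('n)" and L: "pg_line L" and p_L: "p \<in> L"
begin

lemma griesmer_points_in_line_lattice:
  assumes e: "e = 3 * (int s + int t) - griesmer CARD('n) (2 * t)"
  shows "griesmer_points V p L (2 * t) e \<in> line_lattice"
proof -
  define c where "c = flag_coeff CARD('n) (2 * t)"
  have w: "(\<Sum>i<CARD('n). c i * 2 ^ i) = int (2 * t)"
    using sum_flag_coeff_weighted[of 0 "CARD('n)" "2 * t"]
    by (simp add: c_def atLeast0LessThan del: of_nat_mult)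
  have c: "(\<Sum>i<CARD('n). c i) = 4 * int t - griesmer CARD('n) (2 * t)"
    using sum_flag_coeff[of "CARD('n)" "2 * t"] by (simp add: c_def)
  \<comment> \<open>Write \<open>g\<close> for the Griesmer sum. The pencil corrections add up to
    \<open>2t - 2(4t - g) = 2g - 6t\<close> copies of \<open>p\<close>, whereas the target has
    \<open>-2e = 2g - 6t - 6s\<close> copies; the difference is \<open>s\<close> times
    \<open>6p\<close>.\<close>
  have "(\<lambda>x. (\<Sum>i<CARD('n). c i * (of_bool (x \<in> V i) + (2 ^ i - 2) * of_bool (x = p))) +
      (e * of_bool (x \<in> L) - int s * (6 * of_bool (x = p)))) \<in> line_lattice"
  proof (rule line_lattice_add)
    show "(\<lambda>x. \<Sum>i<CARD('n). c i * (of_bool (x \<in> V i) + (2 ^ i - 2) * of_bool (x = p))) \<in> line_lattice"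
      by (rule line_lattice_sum[OF finite_lessThan], rule line_lattice_scale, rule V_lattice) simp
  qed (rule line_lattice_diff[OF line_lattice_scale[OF line_lattice_line[OF L]]
        line_lattice_scale[OF line_lattice_six[OF dim p_nonzero]]])
  then show ?thesis
  proof (rule line_lattice_cong)
    fix x :: "bit^'n"
    have "(\<Sum>i<CARD('n). c i * (of_bool (x \<in> V i) + (2 ^ i - 2) * of_bool (x = p))) =
      (\<Sum>i<CARD('n). c i * of_bool (x \<in> V i)) + ((\<Sum>i<CARD('n). c i * 2 ^ i) - 2 * (\<Sum>i<CARD('n). c i)) * of_bool (x = p)"
      by (simp add: algebra_simps sum.distrib sum_subtractf sum_distrib_left sum_distrib_right)
    then show "(\<Sum>i<CARD('n). c i * (of_bool (x \<in> V i) + (2 ^ i - 2) * of_bool (x = p))) +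
      (e * of_bool (x \<in> L) - int s * (6 * of_bool (x = p))) = griesmer_points V p L (2 * t) e x"
      unfolding griesmer_points_def c_def[symmetric] w c e by (simp add: algebra_simps)
  qed
qed

text \<open>The \<open>i\<close>-th member has \<open>2 * 2 ^ i - 1\<close> points, so the flag
  contributes \<open>2d\<close> minus the sum of its coefficients; the line minus \<open>2p\<close>
  contributes one point.\<close>

lemma sum_griesmer_points:
  "(\<Sum>x\<in>-{0}. griesmer_points V p L d e x) = griesmer CARD('n) d + e"
proof -
  define c where "c = flag_coeff CARD('n) d"
  have w: "(\<Sum>i<CARD('n). c i * 2 ^ i) = int d"
    using sum_flag_coeff_weighted[of 0 "CARD('n)" d] by (simp add: c_def atLeast0LessThan)
  have "(\<Sum>x\<in>-{0}. of_bool (x \<in> V i)) = 2 * 2 ^ i - (1 :: int)" if "i < CARD('n)" for i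
  proof -
    have "-{0} \<inter> V i = V i - {0}" by blast
    then show ?thesis using V_card[OF that] V_0[of i] by (simp add: sum_of_bool_card card_Diff_singleton)
  qed
  then have "(\<Sum>x\<in>-{0}. \<Sum>i<CARD('n). c i * of_bool (x \<in> V i)) = (\<Sum>i<CARD('n). c i * (2 * 2 ^ i - 1))"
    by (subst sum.swap) (simp add: sum_distrib_left[symmetric])
  also have "\<dots> = 2 * int d - (\<Sum>i<CARD('n). c i)"
    unfolding w[symmetric] by (simp add: algebra_simps sum_subtractf sum_distrib_left)
  also have "\<dots> = griesmer CARD('n) d"
    using sum_flag_coeff[of "CARD('n)" d] by (simp add: c_def)
  finally have 1: "(\<Sum>x\<in>-{0}. \<Sum>i<CARD('n). c i * of_bool (x \<in> V i)) = griesmer CARD('n) d" .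
  have "(\<Sum>x\<in>-{0}. of_bool (x \<in> L)) = (3 :: int)"
    using arg_cong[OF sum_mult_at_points[of "{#L#}"], of int] L by simp
  moreover have "(\<Sum>x\<in>-{0}. of_bool (x = p)) = (1 :: int)"
    using p_nonzero by (simp add: of_bool_def)
  ultimately have "(\<Sum>x\<in>-{0}. e * (of_bool (x \<in> L) - 2 * of_bool (x = p))) = e"
    unfolding sum_distrib_left[symmetric] sum_subtractf by simp
  with 1 show ?thesis
    unfolding griesmer_points_def c_def[symmetric] sum.distrib by simp
qed

lemma sum_griesmer_points_hyperplane:
  assumes H: "pg_hyperplane H" and e: "0 \<le> e"
  shows "int d \<le> (\<Sum>x\<in>-H. griesmer_points V p L d e x)"
proof -
  define r where "r = CARD('n)"
  define c where "c = flag_coeff r d"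
  have "r > 0" by (simp add: r_def)
  have "\<not> V (r - 1) \<subseteq> H"
  proof
    assume "V (r - 1) \<subseteq> H"
    then have "H = UNIV" using V_top by (simp add: r_def top.extremum_unique)
    then have "vec.dim H = r" by (simp only: r_def vec_dim_card)
    then show False using H \<open>r > 0\<close> unfolding pg_hyperplane_def r_def[symmetric] by linarith
  qed
  \<comment> \<open>The flag is increasing, so the members contained in \<open>H\<close> are exactly
    those below some index \<open>m\<close>.\<close>
  define m where "m = (LEAST k. \<not> V k \<subseteq> H)"
  have m: "\<not> V m \<subseteq> H" "\<And>k. k < m \<Longrightarrow> V k \<subseteq> H" "m \<le> r - 1"
    unfolding m_def using \<open>\<not> V (r - 1) \<subseteq> H\<close>
    by (fact LeastI[of "\<lambda>k. \<not> V k \<subseteq> H"], metis not_less_Least, fact Least_le[of "\<lambda>k. \<not> V k \<subseteq> H"])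
  have "(\<Sum>x\<in>-H. of_bool (x \<in> V i)) = (if m \<le> i then 2 ^ i else (0 :: int))" if "i < r" for i
  proof -
    have *: "-H \<inter> V i = V i - H" by blast
    show ?thesis
    proof (cases "m \<le> i")
      case True
      then have "\<not> V i \<subseteq> H" using m(1) V_mono by blast
      then have "card (V i) = 2 * card (V i - H)"
        using card_diff_hyperplane[OF H, of "V i"] V_add by blast
      then show ?thesis using V_card that True * by (simp add: sum_of_bool_card r_def)
    next
      case False
      then have "V i - H = {}" using m(2)[of i] by auto
      then show ?thesis using False * by (simp add: sum_of_bool_card)
    qed
  qed
  then have "(\<Sum>x\<in>-H. \<Sum>i<r. c i * of_bool (x \<in> V i)) = (\<Sum>i<r. if m \<le> i then c i * 2 ^ i else 0)"
    by (subst sum.swap) (auto simp: sum_distrib_left[symmetric] intro!: sum.cong)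
  also have "\<dots> = (\<Sum>i | i \<in> {..<r} \<and> m \<le> i. c i * 2 ^ i)"
    by (rule sum.inter_filter[symmetric]) simp
  also have "{i. i \<in> {..<r} \<and> m \<le> i} = {m..<r}" by auto
  also have "(\<Sum>i\<in>{m..<r}. c i * 2 ^ i) = 2 ^ m * \<lceil>real d / 2 ^ m\<rceil>"
    unfolding c_def using m(3) \<open>r > 0\<close> by (intro sum_flag_coeff_weighted) simp
  also have "\<dots> \<ge> int d"
  proof -
    have "real d = 2 ^ m * (real d / 2 ^ m)" by simp
    also have "\<dots> \<le> 2 ^ m * of_int \<lceil>real d / 2 ^ m\<rceil>" by (intro mult_left_mono) simp_all
    finally have "real d \<le> 2 ^ m * of_int \<lceil>real d / 2 ^ m\<rceil>" .
    then have "real_of_int (int d) \<le> real_of_int (2 ^ m * \<lceil>real d / 2 ^ m\<rceil>)" by simp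
    then show ?thesis by (simp only: of_int_le_iff)
  qed
  finally have 1: "int d \<le> (\<Sum>x\<in>-H. \<Sum>i<r. c i * of_bool (x \<in> V i))" .
  have "(\<Sum>x\<in>-H. of_bool (x \<in> L)) + 2 * int (lines_in {#L#} H) = 2"
    using arg_cong[OF sum_mult_at_hyperplane[OF H, of "{#L#}"], of int] L by simp
  moreover have "lines_in {#L#} H = 0" if "p \<notin> H" using p_L that by (auto simp: lines_in_def)
  moreover have "lines_in {#L#} H \<le> 1" by (simp add: lines_in_def)
  moreover have "(\<Sum>x\<in>-H. of_bool (x = p)) = (of_bool (p \<notin> H) :: int)"
    by (simp add: of_bool_def)
  \<comment> \<open>If \<open>p\<close> is off \<open>H\<close>, then \<open>L\<close> is not
    contained in \<open>H\<close> and its two points off \<open>H\<close> make up for the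
    coefficient -2; if \<open>p\<close> is in \<open>H\<close>, nothing is subtracted.\<close>
  ultimately have "0 \<le> (\<Sum>x\<in>-H. of_bool (x \<in> L)) - 2 * (\<Sum>x\<in>-H. of_bool (x = p) :: int)"
    by (cases "p \<in> H") auto
  then have "0 \<le> (\<Sum>x\<in>-H. e * (of_bool (x \<in> L) - 2 * of_bool (x = p)))"
    unfolding sum_distrib_left[symmetric] sum_subtractf using e by simp
  with 1 show ?thesis
    unfolding griesmer_points_def c_def[symmetric] r_def[symmetric] sum.distrib by simp
qed

text \<open>Only the coefficient of the whole space is unbounded; it is reduced modulo \<open>\<mu>\<close>.\<close>

lemma griesmer_points_reduced_bounded:
  assumes "0 \<le> e" "e \<le> E" "\<mu> > 0"
  shows "\<bar>griesmer_points V p L d e x - int (nat \<lceil>real d / 2 ^ (CARD('n) - 1)\<rceil> div \<mu> * \<mu>)\<bar>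
    \<le> int CARD('n) + int \<mu> + 2 * E"
proof -
  define r where "r = CARD('n) - 1"
  have r: "CARD('n) = Suc r" by (simp add: r_def)
  define u where "u = nat \<lceil>real d / 2 ^ r\<rceil>"
  have "0 \<le> \<lceil>real d / 2 ^ r\<rceil>" by (simp add: ceiling_mono[of 0, simplified])
  then have u: "\<lceil>real d / 2 ^ r\<rceil> = int u" by (simp add: u_def)
  have "flag_coeff (Suc r) d r = int u"
    by (simp add: flag_coeff_def griesmer_term_def u)
  \<comment> \<open>The top member is the whole space, so at every vector its coefficient
    \<open>u\<close> is reduced to \<open>u mod \<mu>\<close>.\<close>
  then have "griesmer_points V p L d e x - int (u div \<mu> * \<mu>) =
      (\<Sum>i<r. flag_coeff (Suc r) d i * of_bool (x \<in> V i)) + int (u mod \<mu>) + e * (of_bool (x \<in> L) - 2 * of_bool (x = p))"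
    using V_top unfolding griesmer_points_def r
    by (simp add: minus_div_mult_eq_mod[symmetric] of_nat_diff div_times_less_eq_dividend)
  also have "\<bar>\<dots>\<bar> \<le> (\<Sum>i<r. 1) + int \<mu> + 2 * E"
  proof -
    have "\<bar>\<Sum>i<r. flag_coeff (Suc r) d i * of_bool (x \<in> V i)\<bar> \<le> (\<Sum>i<r. \<bar>flag_coeff (Suc r) d i * of_bool (x \<in> V i)\<bar>)"
      by (rule sum_abs)
    also have "\<dots> \<le> (\<Sum>i<r. 1)"
      using flag_coeff_bound[of _ "Suc r" d] by (intro sum_mono) (auto simp: of_bool_def)
    finally have "\<bar>\<Sum>i<r. flag_coeff (Suc r) d i * of_bool (x \<in> V i)\<bar> \<le> (\<Sum>i<r. 1)" .
    moreover have "int (u mod \<mu>) \<le> int \<mu>" using assms(3) by (simp add: less_imp_le)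
    moreover have "\<bar>e * (of_bool (x \<in> L) - 2 * of_bool (x = p))\<bar> \<le> 2 * E"
      using assms by (auto simp: of_bool_def)
    ultimately show ?thesis by (smt (verit) of_nat_0_le_iff)
  qed
  finally show ?thesis unfolding u_def r_def[symmetric] using r by simp
qed

end

subsection \<open>Attaining the bound\<close>

text \<open>Bounding the slack by \<open>E\<close> leaves finitely many reduced point multisets, so
  one threshold works for all \<open>t\<close> and \<open>s\<close>.\<close>

lemma exists_line_system:
  assumes dim: "3 \<le> CARD('n::finite)"
  shows "\<exists>t0. \<forall>t\<ge>t0. \<forall>s. griesmer CARD('n) (2 * t) \<le> 3 * (int s + int t) \<longrightarrow>
    3 * (int s + int t) \<le> griesmer CARD('n) (2 * t) + E \<longrightarrow>
    (\<exists>M :: (bit^'n) set multiset. (\<forall>L\<in>#M. pg_line L) \<and> size M = s + t \<and>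
      (\<forall>H. pg_hyperplane H \<longrightarrow> lines_in M H \<le> s))"
proof -
  obtain P :: "(bit^'n) set multiset" and \<mu> where \<mu>: "\<mu> > 0"
    and P: "\<And>L. L \<in># P \<longleftrightarrow> pg_line L" "\<And>x. x \<noteq> 0 \<Longrightarrow> mult_at P x = \<mu>"
    using uniform_line_cover[OF dim] by metis
  obtain p :: "bit^'n" and V where flag: "pg_flag p V"
    using pg_flag_exists by blast
  interpret pg_flag p V by (rule flag)
  obtain q where q: "q \<noteq> 0" "q \<noteq> p"
  proof -
    have "card {0, p} < card (V 1)" using dim V_card[of 1] p_nonzero by simp
    then have "\<not> V 1 \<subseteq> {0, p}" by (meson card_mono finite_bit_vec not_le)
    then show thesis using that by blast
  qed
  define L where "L = line_thru p q"
  have L: "pg_line L" "p \<in> L" using p_nonzero q by (auto simp: L_def pg_line_iff)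
  interpret pg_flag_line p V L by unfold_locales (use dim L in auto)
  define K where "K = int CARD('n) + int \<mu> + 2 * E"
  obtain m0 where m0: "\<And>f m. f \<in> line_lattice \<Longrightarrow> \<forall>x :: bit^'n. \<bar>f x\<bar> \<le> K \<Longrightarrow> m0 \<le> m \<Longrightarrow>
    \<exists>M. (\<forall>L\<in>#M. pg_line L) \<and> (\<forall>x. x \<noteq> 0 \<longrightarrow> int (mult_at M x) = f x + int (m * \<mu>))"
    using line_lattice_bounded_shift_nonneg[OF P, of K] by blast
  have "\<exists>M :: (bit^'n) set multiset. (\<forall>L\<in>#M. pg_line L) \<and> size M = s + t \<and>
      (\<forall>H. pg_hyperplane H \<longrightarrow> lines_in M H \<le> s)"
    if t: "2 ^ (CARD('n) - 1) * (m0 * \<mu>) \<le> t"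
      and s: "griesmer CARD('n) (2 * t) \<le> 3 * (int s + int t)"
        "3 * (int s + int t) \<le> griesmer CARD('n) (2 * t) + E" for s t
  proof -
    define e where "e = 3 * (int s + int t) - griesmer CARD('n) (2 * t)"
    have e: "0 \<le> e" "e \<le> E" using s by (simp_all add: e_def)
    define g where "g = griesmer_points V p L (2 * t) e"
    define m where "m = nat \<lceil>real (2 * t) / 2 ^ (CARD('n) - 1)\<rceil> div \<mu>"
    \<comment> \<open>The bound on \<open>t\<close> makes the coefficient of the whole space at
      least \<open>m0 * \<mu>\<close>, so at least \<open>m0\<close> multiples of
      \<open>\<mu>\<close> can be split off.\<close>
    have "m0 \<le> m"
    proof -
      have "real (2 ^ (CARD('n) - 1) * (m0 * \<mu>)) \<le> real (2 * t)" using t by linarith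
      then have "real (m0 * \<mu>) \<le> real (2 * t) / 2 ^ (CARD('n) - 1)" by (simp add: field_simps)
      then have "m0 * \<mu> \<le> nat \<lceil>real (2 * t) / 2 ^ (CARD('n) - 1)\<rceil>" by linarith
      then show ?thesis unfolding m_def using \<mu> by (simp add: less_eq_div_iff_mult_less_eq)
    qed
    have "(\<lambda>x :: bit^'n. int (m * \<mu>)) \<in> line_lattice"
      by (rule line_latticeI[of "repeat_mset m P" "{#}"])
        (use P in \<open>auto simp flip: count_greater_zero_iff\<close>)
    then have "(\<lambda>x. g x - int (m * \<mu>)) \<in> line_lattice"
      unfolding g_def using griesmer_points_in_line_lattice[OF e_def] by (rule line_lattice_diff[rotated])
    moreover have "\<forall>x. \<bar>g x - int (m * \<mu>)\<bar> \<le> K"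
      unfolding g_def m_def K_def using griesmer_points_reduced_bounded[OF e \<mu>] by blast
    ultimately have "\<exists>M. (\<forall>L\<in>#M. pg_line L) \<and> (\<forall>x. x \<noteq> 0 \<longrightarrow> int (mult_at M x) = g x - int (m * \<mu>) + int (m * \<mu>))"
      using \<open>m0 \<le> m\<close> by (rule m0)
    then obtain M where M: "\<forall>L\<in>#M. pg_line L" "\<And>x. x \<noteq> 0 \<Longrightarrow> int (mult_at M x) = g x"
      by auto
    \<comment> \<open>The choice of \<open>e\<close> fills the Griesmer sum up to exactly three
      points for each of the \<open>s + t\<close> lines.\<close>
    have "3 * int (size M) = (\<Sum>x\<in>-{0}. g x)"
      using arg_cong[OF sum_mult_at_points[OF M(1)], of int] M(2) by simp
    also have "\<dots> = 3 * (int s + int t)"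
      unfolding g_def sum_griesmer_points by (simp add: e_def)
    finally have "int (size M) = int (s + t)" by simp
    then have size: "size M = s + t" by (simp only: of_nat_eq_iff)
    have "lines_in M H \<le> s" if H: "pg_hyperplane H" for H
    proof -
      have "0 \<in> H" using H by (simp add: pg_hyperplane_def vec.subspace_0)
      then have "(\<Sum>x\<in>-H. g x) = (\<Sum>x\<in>-H. int (mult_at M x))"
        using M(2) by (intro sum.cong refl) (metis ComplD)
      then have "(\<Sum>x\<in>-H. g x) + 2 * int (lines_in M H) = 2 * int (size M)"
        using arg_cong[OF sum_mult_at_hyperplane[OF H M(1)], of int] by simp
      moreover have "int (2 * t) \<le> (\<Sum>x\<in>-H. g x)"
        unfolding g_def by (rule sum_griesmer_points_hyperplane[OF H e(1)])
      ultimately show ?thesis using size by linarith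
    qed
    with M(1) size show ?thesis by blast
  qed
  then show ?thesis by blast
qed

text \<open>With \<open>n = s + t\<close>, the first three Griesmer terms already force
  \<open>3t + t/2 \<le> 3(s + t)\<close>, hence \<open>t \<le> 6s\<close>. This makes the set of
  lengths finite.\<close>

lemma griesmer_lengths_le:
  assumes "3 \<le> r" "n \<in> griesmer_lengths r s"
  shows "n \<le> 7 * s"
proof -
  define t where "t = n - s"
  have n: "n = s + t" "griesmer r (2 * t) \<le> 3 * int n"
    using assms(2) by (auto simp: griesmer_lengths_def t_def)
  have "0 \<le> \<lceil>real (2 * t) / 2 ^ i\<rceil>" for i
    using ceiling_mono[of 0 "real (2 * t) / 2 ^ i"] by simp
  then have "(\<Sum>i<3. \<lceil>real (2 * t) / 2 ^ i\<rceil>) \<le> griesmer r (2 * t)"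
    unfolding griesmer_def using assms(1)
    by (intro sum_mono2) auto
  moreover have "(\<Sum>i<3. \<lceil>real (2 * t) / 2 ^ i\<rceil>) = 3 * int t + \<lceil>real t / 2\<rceil>"
    using ceiling_of_int[of "2 * int t", where 'a = real] by (simp add: eval_nat_numeral)
  ultimately have "\<lceil>real t / 2\<rceil> \<le> 3 * int s" using n by simp
  then show ?thesis using n(1) by linarith
qed

theorem theorem3p14:
  assumes "3 \<le> CARD('n::finite)"
  shows "\<exists>s0. \<forall>s\<ge>s0.
           is_maximum (spanning_lengths TYPE('n) s) (n_half TYPE('n) s) \<and>
           is_maximum (griesmer_lengths CARD('n) s) (n_half TYPE('n) s)"
proof -
  define r where "r = CARD('n)"
  obtain t0 where t0: "\<And>t s. t0 \<le> t \<Longrightarrow> griesmer r (2 * t) \<le> 3 * (int s + int t) \<Longrightarrow>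
    3 * (int s + int t) \<le> griesmer r (2 * t) + 2 * int r \<Longrightarrow>
    \<exists>M :: (bit^'n) set multiset. (\<forall>L\<in>#M. pg_line L) \<and> size M = s + t \<and>
      (\<forall>H. pg_hyperplane H \<longrightarrow> lines_in M H \<le> s)"
    using exists_line_system[OF assms, of "2 * int r"] unfolding r_def by blast
  have "is_maximum (spanning_lengths TYPE('n) s) (n_half TYPE('n) s) \<and>
      is_maximum (griesmer_lengths r s) (n_half TYPE('n) s)"
    if s: "nat (griesmer r (2 * Suc t0)) \<le> s" for s
  proof -
    have fin: "finite (griesmer_lengths r s)"
    proof (rule finite_subset)
      show "griesmer_lengths r s \<subseteq> {..7 * s}"
        using griesmer_lengths_le[of r _ s] assms unfolding r_def by blast
    qed simp
    \<comment> \<open>The lower bound on \<open>s\<close> makes this length admissible, which forces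
      \<open>t0 < t\<close> for the maximal length \<open>N = s + t\<close>.\<close>
    have mem: "s + Suc t0 \<in> griesmer_lengths r s"
      using s by (simp add: griesmer_lengths_def)
    define N where "N = Max (griesmer_lengths r s)"
    have N: "N \<in> griesmer_lengths r s" "\<And>n. n \<in> griesmer_lengths r s \<Longrightarrow> n \<le> N"
      using fin mem unfolding N_def by (auto intro: Max_in)
    define t where "t = N - s"
    have t: "N = s + t" "t0 \<le> t" "0 < t" "griesmer r (2 * t) \<le> 3 * int N"
      using N(1) N(2)[OF mem] by (auto simp: t_def griesmer_lengths_def)
    have "Suc N \<notin> griesmer_lengths r s" using N(2) by fastforce
    then have next_gt: "3 * int (Suc N) < griesmer r (2 * t + 2)"
      using t(1) by (simp add: griesmer_lengths_def not_le)
    \<comment> \<open>Since \<open>Suc N\<close> violates the inequality, the slack at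
      \<open>N\<close> is at most \<open>2r\<close>.\<close>
    then have "3 * int N \<le> griesmer r (2 * t) + 2 * int r"
      using griesmer_step[of r "2 * t"] by simp
    with t0[OF t(2), of s] t(1,4)
    obtain M :: "(bit^'n) set multiset" where M: "\<forall>L\<in>#M. pg_line L" "size M = N"
      "\<And>H. pg_hyperplane H \<Longrightarrow> lines_in M H \<le> s" by auto
    \<comment> \<open>If every hyperplane contained at most \<open>s - 1\<close> lines, the Griesmer
      bound for \<open>s - 1\<close> would apply with weight \<open>2t + 2\<close> and contradict
      \<open>next_gt\<close>.\<close>
    have "\<exists>H. pg_hyperplane H \<and> lines_in M H = s"
    proof (rule ccontr)
      assume "\<not> ?thesis"
      with M(3) have less: "lines_in M H < s" if "pg_hyperplane H" for H
        using that le_neq_implies_less by blast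
      \<comment> \<open>Any nonzero vector supplies a hyperplane; this gives \<open>0 < s\<close>,
        so the truncated \<open>s - 1\<close> is exact.\<close>
      have "(1 :: bit^'n) \<noteq> 0" by simp
      from less[OF pg_hyperplane_dotb[OF this]] have "0 < s" by simp
      have "griesmer r (2 * (size M - (s - 1))) \<le> 3 * int (size M)"
        unfolding r_def using M(1) less by (intro griesmer_lines) force+
      moreover have "2 * (size M - (s - 1)) = 2 * t + 2" using M(2) t(1) \<open>0 < s\<close> by simp
      ultimately show False using next_gt M(2) by simp
    qed
    with M t(1,3) have "spanning_system N s M"
      by (auto simp: spanning_system_def line_system_def)
    then have N_span: "N \<in> spanning_lengths TYPE('n) s" by (auto simp: spanning_lengths_def)
    \<comment> \<open>By the Griesmer bound every spanning length lies in the finite set whose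
      maximum \<open>N\<close> is realized by \<open>M\<close>.\<close>
    have sub: "spanning_lengths TYPE('n) s \<subseteq> griesmer_lengths r s"
      unfolding spanning_lengths_def spanning_system_def line_system_def griesmer_lengths_def r_def
      using griesmer_lines[where 'n = 'n] by blast
    have "n_half TYPE('n) s = N"
      unfolding n_half_def using fin sub N(2) N_span by (intro Max_eqI) (auto intro: finite_subset)
    with N N_span sub show ?thesis by (auto simp: is_maximum_def)
  qed
  then show ?thesis unfolding r_def by blast
qed

end
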